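(* Let $W$ be a finite set, let $a:W\to\mathbb{N}$ and $d:W\to\mathbb{N}$ be functions, and for $S\subseteq W$ put $C_S(q,t)=\sum_{w\in S}q^{a(w)}t^{d(w)}$. Let $I\subseteq W$ and $T\subseteq W$, and suppose $f:W\setminus T\to W\setminus I$ is a bijection such that $a(f(w))=a(w)-1$ and $d(f(w))=d(w)+1$ for all $w\in W\setminus T$. If $C_T(q,t)=C_I(t,q)$, then $C_W(q,t)=C_W(t,q)$.
   Context: Here $\mathbb{N}=\{0,1,2,\dots\}$ and $q,t$ are indeterminates. *)

theory Defs
  imports Main "HOL-Computational_Algebra.Polynomial"
begin

text \<open>The polynomial ring \<open>\<int>[q,t]\<close> is rendered as \<open>\<int>[q][t]\<close>: \<open>q\<close> is the indeterminate of the
  coefficient ring, \<open>t\<close> the outer one.\<close>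

definition q_var :: "int poly poly"
  where "q_var = [:[:0, 1:]:]"

definition t_var :: "int poly poly"
  where "t_var = [:0, 1:]"

text \<open>The two ring arguments are what is substituted for the first and second variable, so
  \<open>C\<^sub>S(q,t)\<close> is \<open>bigen a d S q_var t_var\<close> and \<open>C\<^sub>S(t,q)\<close> is \<open>bigen a d S t_var q_var\<close>.\<close>

definition bigen :: "('w \<Rightarrow> nat) \<Rightarrow> ('w \<Rightarrow> nat) \<Rightarrow> 'w set \<Rightarrow> 'r \<Rightarrow> 'r \<Rightarrow> 'r::comm_semiring_1"
  where "bigen a d S x y = (\<Sum>w\<in>S. x ^ a w * y ^ d w)"

end

theory Submission
  imports Defs
begin

text \<open>Applying \<open>f\<close> multiplies a monomial by \<open>t / q\<close>, so
  \<open>q (C\<^sub>W - C\<^sub>I) = t (C\<^sub>W - C\<^sub>T)\<close>, that is, \<open>(q - t) C\<^sub>W = q C\<^sub>I - t C\<^sub>T\<close>.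
  Exchanging \<open>q\<close> and \<open>t\<close> negates the right-hand side, because it exchanges \<open>C\<^sub>I\<close> and \<open>C\<^sub>T\<close>;
  it also negates \<open>q - t\<close>, which can be cancelled.\<close>

lemma bigen_commute: "bigen a d S x y = bigen d a S y x"
  by (simp add: bigen_def mult.commute)

lemma coeff_q_power_times_t_power:
  "coeff (coeff (q_var ^ m * t_var ^ n) j) i = of_bool (i = m \<and> j = n)"
proof -
  have "q_var ^ m * t_var ^ n = [:monom 1 m:] * monom 1 n"
    unfolding q_var_def t_var_def poly_const_pow monom_altdef smult_1_left ..
  also have "\<dots> = monom (monom 1 m) n"
    by (simp only: mult_pCons_left mult_zero_left smult_monom mult_1_right pCons_0_0 add_0_right)
  finally have "q_var ^ m * t_var ^ n = monom (monom 1 m) n" .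
  then show ?thesis
    by (auto simp only: coeff_monom coeff_0 of_bool_def split: if_splits)
qed

text \<open>For finite \<open>S\<close>, the coefficient of q^i t^j in C_S(q,t) counts the
  \<open>w\<close> in \<open>S\<close> with \<open>a w = i\<close> and \<open>d w = j\<close>, so
  exchanging the variables transposes the coefficients.\<close>

lemma coeff_bigen_swap:
  "coeff (coeff (bigen a d S q_var t_var) j) i = coeff (coeff (bigen a d S t_var q_var) i) j"
proof -
  have "coeff (coeff (bigen a d S q_var t_var) j) i
      = coeff (coeff (bigen d a S q_var t_var) i) j"
    by (simp add: bigen_def coeff_sum coeff_q_power_times_t_power conj_commute)
  then show ?thesis
    by (simp add: bigen_commute[of d])
qed

text \<open>An equation between the fixed elements \<open>q_var\<close> and \<open>t_var\<close> is
  not an identity in free \<open>x\<close> and \<open>y\<close>; transposing coefficients takes the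
  place of the automorphism that exchanges them.\<close>

lemma bigen_eq_swap:
  assumes "bigen a d S q_var t_var = bigen a' d' S' t_var q_var"
  shows "bigen a d S t_var q_var = bigen a' d' S' q_var t_var"
  by (intro poly_eqI) (metis assms coeff_bigen_swap)

text \<open>Reindex along \<open>f\<close>: one factor \<open>x\<close> restores the exponent lost
  in \<open>a\<close>, and one factor \<open>y\<close> comes out of the raised exponent
  \<open>d\<close>. Keeping \<open>x\<close> and \<open>y\<close> arbitrary allows both orders of
  the variables.\<close>

lemma bigen_telescope:
  fixes x y :: "'r::comm_ring_1"
  assumes "finite W" "I \<subseteq> W" "T \<subseteq> W" "bij_betw f (W - T) (W - I)"
    and a: "\<And>w. w \<in> W - T \<Longrightarrow> a w = Suc (a (f w))"
    and d: "\<And>w. w \<in> W - T \<Longrightarrow> d (f w) = Suc (d w)"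
  shows "(x - y) * bigen a d W x y = x * bigen a d I x y - y * bigen a d T x y"
proof -
  have "x * bigen a d (W - I) x y = x * (\<Sum>w\<in>W - T. x ^ a (f w) * y ^ d (f w))"
    unfolding bigen_def
    using sum.reindex_bij_betw[OF assms(4), of "\<lambda>w. x ^ a w * y ^ d w"] by (rule arg_cong[OF sym])
  also have "\<dots> = y * bigen a d (W - T) x y"
    unfolding bigen_def sum_distrib_left
    by (intro sum.cong) (simp_all add: a d)
  finally have "x * bigen a d (W - I) x y = y * bigen a d (W - T) x y" .
  moreover have "bigen a d (W - S) x y = bigen a d W x y - bigen a d S x y" if "S \<subseteq> W" for S
    unfolding bigen_def using \<open>finite W\<close> that by (rule sum_diff)
  ultimately show ?thesis
    using assms(2,3) by (simp add: algebra_simps)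
qed

theorem theorem2p1:
  fixes W I T :: "'w set"
    and a d :: "'w \<Rightarrow> nat"
    and f :: "'w \<Rightarrow> 'w"
  assumes "finite W"
    and "I \<subseteq> W"
    and "T \<subseteq> W"
    and "bij_betw f (W - T) (W - I)"
    and "\<And>w. w \<in> W - T \<Longrightarrow> int (a (f w)) = int (a w) - 1"
    and "\<And>w. w \<in> W - T \<Longrightarrow> d (f w) = d w + 1"
    and "bigen a d T q_var t_var = bigen a d I t_var q_var"
  shows "bigen a d W q_var t_var = bigen a d W t_var q_var"
proof -
  have tele: "(x - y) * bigen a d W x y = x * bigen a d I x y - y * bigen a d T x y"
    for x y :: "int poly poly"
  proof (rule bigen_telescope[OF assms(1-4)])
    \<comment> \<open>The subtraction is over the integers, so it forces \<open>a w\<close> to be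
      positive.\<close>
    show "a w = Suc (a (f w))" if "w \<in> W - T" for w
      using assms(5)[OF that] by simp
    show "d (f w) = Suc (d w)" if "w \<in> W - T" for w
      using assms(6)[OF that] by simp
  qed
  \<comment> \<open>\<open>tele\<close> in the order (t,q) involves C_T(t,q), which
    \<open>bigen_eq_swap\<close> turns into C_I(q,t).\<close>
  have "(q_var - t_var) * bigen a d W q_var t_var = (q_var - t_var) * bigen a d W t_var q_var"
    using tele[of q_var t_var] tele[of t_var q_var] assms(7) bigen_eq_swap[OF assms(7)]
    by (simp add: algebra_simps)
  moreover have "q_var - t_var \<noteq> 0"
    by (simp add: q_var_def t_var_def)
  ultimately show ?thesis
    by simp
qed

end
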